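(* Let $L$ be the signed Laplacian of an Adinkra with $N$ colors and vertex set $V$. Then the eigenvalues of $L$ are $N+\sqrt N$ and $N-\sqrt N$, each of multiplicity $\frac{\#V}{2}$, and $$L^2=2NL-N(N-1)I.$$ Moreover $\det(L)=(N(N-1))^{\#V/2}$.
   Context: A signed graph is a finite undirected simple graph $(V,E)$ with a signature $\mu:E\to\{-1,1\}$; edges with $\mu(e)=-1$ are called dashed, those with $\mu(e)=1$ solid. An Adinkra with $N\ge 1$ colors is a non-empty finite bipartite signed graph $(V,E,\mu)$ (with a fixed bipartition of $V$ into bosons and fermions, every edge joining a boson to a fermion), together with an assignment of one of $N$ colors to each edge and a function $h:V\to\mathbb{Z}$ (the function $h$ plays no role here), such that: (i) each vertex is incident to exactly $N$ edges, one of each color; (ii) for any two distinct colors, the subgraph consisting of all edges of those two colors is a disjoint union of $4$-cycles (called bicolor cycles); (iii) every bicolor cycle contains an odd number of dashed edges; (iv) $|h(v)-h(w)|=1$ for adjacent $v,w$. An Adinkra need not be connected. The signed adjacency matrix $A$ has $A_{ij}=\mu(e)$ if there is an edge $e$ between the $i$th and $j$th vertices, and $0$ otherwise. The signed Laplacian is $L=D-A$, with $D$ the diagonal matrix of vertex degrees; for an Adinkra $L=NI-A$. *)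

theory Defs
  imports Jordan_Normal_Form.Char_Poly
begin

locale signed_graph =
  fixes V :: "'v set" and E :: "'v set set" and \<mu> :: "'v set \<Rightarrow> int"
  assumes finite_V: "finite V"
    and edges: "e \<in> E \<Longrightarrow> e \<subseteq> V \<and> card e = 2"
    and signature: "e \<in> E \<Longrightarrow> \<mu> e \<in> {-1, 1}"

text \<open>Cycles are represented by their edge sets; the vertices of such a cycle \<open>C\<close> are \<open>\<Union> C\<close>.\<close>

definition is_4_cycle :: "'v set set \<Rightarrow> bool" where
  "is_4_cycle C \<longleftrightarrow>
    (\<exists>a b c d. distinct [a, b, c, d] \<and> C = {{a, b}, {b, c}, {c, d}, {d, a}})"

definition disjoint_union_of_4_cycles :: "'v set \<Rightarrow> 'v set set \<Rightarrow> bool" where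
  "disjoint_union_of_4_cycles W F \<longleftrightarrow>
    (\<exists>\<C>. (\<forall>C\<in>\<C>. is_4_cycle C)
       \<and> (\<forall>C\<in>\<C>. \<forall>C'\<in>\<C>. C \<noteq> C' \<longrightarrow> \<Union> C \<inter> \<Union> C' = {})
       \<and> \<Union> \<C> = F \<and> \<Union> F = W)"

definition bicolor_edges :: "'v set set \<Rightarrow> ('v set \<Rightarrow> nat) \<Rightarrow> nat \<Rightarrow> nat \<Rightarrow> 'v set set" where
  "bicolor_edges E color i j = {e \<in> E. color e = i \<or> color e = j}"

text \<open>When the two-colored subgraph is a disjoint union of 4-cycles, the 4-cycles contained in
  it are exactly the cycles of that decomposition.\<close>

definition bicolor_cycle ::
    "'v set set \<Rightarrow> ('v set \<Rightarrow> nat) \<Rightarrow> nat \<Rightarrow> nat \<Rightarrow> 'v set set \<Rightarrow> bool" where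
  "bicolor_cycle E color i j C \<longleftrightarrow> is_4_cycle C \<and> C \<subseteq> bicolor_edges E color i j"

locale adinkra = signed_graph V E \<mu>
  for V :: "'v set" and E :: "'v set set" and \<mu> :: "'v set \<Rightarrow> int" +
  fixes bosons fermions :: "'v set"
    and N :: nat
    and color :: "'v set \<Rightarrow> nat"
    and h :: "'v \<Rightarrow> int"
  assumes nonempty: "V \<noteq> {}"
    and bipartition: "bosons \<union> fermions = V" "bosons \<inter> fermions = {}"
    and bipartite: "e \<in> E \<Longrightarrow> \<exists>b\<in>bosons. \<exists>f\<in>fermions. e = {b, f}"
    and N_pos: "N \<ge> 1"
    and color_range: "e \<in> E \<Longrightarrow> color e \<in> {1..N}"
    and regular: "v \<in> V \<Longrightarrow> card {e \<in> E. v \<in> e} = N"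
    and one_of_each_color: "v \<in> V \<Longrightarrow> i \<in> {1..N} \<Longrightarrow> \<exists>!e. e \<in> E \<and> v \<in> e \<and> color e = i"
    and bicolor_subgraph: "i \<in> {1..N} \<Longrightarrow> j \<in> {1..N} \<Longrightarrow> i \<noteq> j \<Longrightarrow>
      disjoint_union_of_4_cycles V (bicolor_edges E color i j)"
    and odd_dashed: "i \<in> {1..N} \<Longrightarrow> j \<in> {1..N} \<Longrightarrow> i \<noteq> j \<Longrightarrow> bicolor_cycle E color i j C \<Longrightarrow>
      odd (card {e \<in> C. \<mu> e = -1})"
    and height: "{v, w} \<in> E \<Longrightarrow> \<bar>h v - h w\<bar> = 1"

text \<open>The list \<open>vs\<close> enumerates the vertices without repetition and fixes the order of the rows
  and columns. Edges have two elements, so the diagonal of the adjacency matrix is zero.\<close>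

definition signed_adjacency_matrix ::
    "'v list \<Rightarrow> 'v set set \<Rightarrow> ('v set \<Rightarrow> int) \<Rightarrow> real mat" where
  "signed_adjacency_matrix vs E \<mu> = mat (length vs) (length vs)
    (\<lambda>(i, j). if {vs ! i, vs ! j} \<in> E then of_int (\<mu> {vs ! i, vs ! j}) else 0)"

definition degree_matrix :: "'v list \<Rightarrow> 'v set set \<Rightarrow> real mat" where
  "degree_matrix vs E = mat_diag (length vs) (\<lambda>i. of_nat (card {e \<in> E. vs ! i \<in> e}))"

definition signed_laplacian ::
    "'v list \<Rightarrow> 'v set set \<Rightarrow> ('v set \<Rightarrow> int) \<Rightarrow> real mat" where
  "signed_laplacian vs E \<mu> = degree_matrix vs E - signed_adjacency_matrix vs E \<mu>"

end

theory Submission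
  imports Defs
begin

text \<open>
  The signed adjacency matrix \<open>A\<close> of an Adinkra satisfies \<open>A\<^sup>2 = N I\<close>. Indeed, the entry of
  \<open>A\<^sup>2\<close> at \<open>(u, w)\<close> is the signed number of paths \<open>u, v, w\<close> of length two. For \<open>u = w\<close> every
  path counts \<open>1\<close> and there are \<open>N\<close> of them. For \<open>u \<noteq> w\<close> the two edges of a path have different
  colors, so they lie on a bicolor cycle \<open>u, v, w, x\<close>, and the path \<open>u, x, w\<close> on the other side of
  this cycle has the opposite sign because the cycle has an odd number of dashed edges. Passing to
  the other side of the cycle is an involution on these paths, so they cancel
  (\<open>bicolor_square\<close>, \<open>sum_adj_paths_distinct\<close>). Since \<open>L = N I - A\<close>, the quadratic equation for
  \<open>L\<close> follows by expanding \<open>L\<^sup>2\<close>.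

  This equation confines the eigenvalues of \<open>L\<close> to the two roots \<open>a, b = N \<plusminus> \<surd>N\<close> but leaves their
  multiplicities open. These come from bipartiteness: the diagonal matrix \<open>S\<close> which is \<open>1\<close> on bosons
  and \<open>-1\<close> on fermions anticommutes with \<open>A\<close>, hence \<open>t I + A\<close> and \<open>t I - A\<close> have the same
  determinant, and the square of this determinant is \<open>det (t\<^sup>2 I - A\<^sup>2) = (t\<^sup>2 - N)\<^sup>n\<close> with
  \<open>n = #V\<close> (\<open>det_shift_anticommuting_root\<close>). With \<open>t = x - N\<close> this says that the characteristic
  polynomial \<open>p\<close> of \<open>L\<close> satisfies \<open>p\<^sup>2 = ((X - a) (X - b))\<^sup>n\<close>. Comparing the orders of the
  distinct roots shows that \<open>n\<close> is even and that both roots of \<open>p\<close> have multiplicity \<open>n/2\<close>; as \<open>p\<close>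
  is monic, \<open>p = ((X - a) (X - b))\<^bsup>n/2\<^esup>\<close> (\<open>monic_square_root_of_power\<close>). As \<open>n\<close>
  is even, the determinant is the value of \<open>p\<close> at \<open>0\<close>.
\<close>

section \<open>Cycles of length four\<close>

text \<open>The labelling of a 4-cycle can be rotated and reflected so that it starts with a prescribed
  pair of consecutive edges; only the eight symmetries of the square have to be inspected.\<close>

lemma is_4_cycle_through_path:
  assumes "is_4_cycle C" and "{u, v} \<in> C" and "{v, w} \<in> C" and "u \<noteq> w"
  obtains x where "distinct [u, v, w, x]" and "C = {{u, v}, {v, w}, {w, x}, {x, u}}"
proof -
  obtain a b c d where dist: "distinct [a, b, c, d]"
    and C: "C = {{a, b}, {b, c}, {c, d}, {d, a}}"
    using assms(1) is_4_cycle_def[of C] by auto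
  have edge: "(y, z) \<in> {(a, b), (b, a), (b, c), (c, b), (c, d), (d, c), (d, a), (a, d)}"
    if "{y, z} \<in> C" for y z
    using that unfolding C insert_iff doubleton_eq_iff by blast
  have "\<exists>x. (u, v, w, x) \<in> {(a, b, c, d), (b, c, d, a), (c, d, a, b), (d, a, b, c),
      (c, b, a, d), (d, c, b, a), (a, d, c, b), (b, a, d, c)}"
    using edge[OF assms(2)] edge[OF assms(3)] assms(4) dist
    by (elim insertE emptyE; clarsimp)
  then obtain x where "(u, v, w, x) \<in> {(a, b, c, d), (b, c, d, a), (c, d, a, b), (d, a, b, c),
      (c, b, a, d), (d, c, b, a), (a, d, c, b), (b, a, d, c)}"
    by blast
  then have "distinct [u, v, w, x] \<and> C = {{u, v}, {v, w}, {w, x}, {x, u}}"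
    using dist unfolding C by (elim insertE) (auto simp add: insert_commute)
  then show thesis using that by blast
qed

lemma prod_signs:
  fixes s :: "'a \<Rightarrow> int"
  assumes "finite C" and "\<And>e. e \<in> C \<Longrightarrow> s e \<in> {-1, 1}"
  shows "prod s C = (-1) ^ card {e \<in> C. s e = -1}"
proof -
  have "prod s C = (\<Prod>e\<in>C. if s e = -1 then -1 else 1)"
    using assms(2) by (intro prod.cong) auto
  also have "\<dots> = (\<Prod>e | e \<in> C \<and> s e = -1. -1)"
    using assms(1) by (intro prod.inter_filter[symmetric])
  also have "\<dots> = (-1) ^ card {e \<in> C. s e = -1}"
    by simp
  finally show ?thesis .
qed

lemma prod_4_cycle:
  fixes s :: "'v set \<Rightarrow> int"
  assumes "distinct [u, v, w, x]"
  shows "prod s {{u, v}, {v, w}, {w, x}, {x, u}} = s {u, v} * s {v, w} * s {w, x} * s {x, u}"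
proof -
  have "{u, v} \<notin> {{v, w}, {w, x}, {x, u}}" "{v, w} \<notin> {{w, x}, {x, u}}" "{w, x} \<noteq> {x, u}"
    using assms by (auto simp: doubleton_eq_iff)
  then show ?thesis by (simp add: mult.assoc)
qed

section \<open>The square of the signed adjacency function\<close>

context adinkra
begin

lemma edge_ends: "{u, v} \<in> E \<Longrightarrow> u \<in> V \<and> v \<in> V \<and> u \<noteq> v"
  using edges[of "{u, v}"] by (auto simp: card_insert_if split: if_splits)

lemma edge_eqI_same_color:
  assumes "e \<in> E" "e' \<in> E" "v \<in> e" "v \<in> e'" "color e = color e'"
  shows "e = e'"
proof -
  have "v \<in> V" using assms edges by blast
  from one_of_each_color[OF this color_range[OF assms(1)]] assms show ?thesis by metis
qed

text \<open>The two edges of a path from \<open>u\<close> to \<open>w\<close> meet in \<open>v\<close> and so belong to the same component of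
  the subgraph of their two colors, which is a 4-cycle. Around it the colors alternate, and the odd
  number of dashed edges makes the product of its four signs \<open>-1\<close>, so its two halves have opposite
  signs.\<close>

lemma bicolor_square:
  assumes uv: "{u, v} \<in> E" and vw: "{v, w} \<in> E" and "u \<noteq> w"
  obtains x where "{u, x} \<in> E" and "{x, w} \<in> E"
    and "color {u, x} = color {v, w}" and "color {x, w} = color {u, v}"
    and "\<mu> {u, x} * \<mu> {x, w} = - (\<mu> {u, v} * \<mu> {v, w})"
proof -
  define i where "i = color {u, v}"
  define j where "j = color {v, w}"
  have ne: "{u, v} \<noteq> {v, w}" using \<open>u \<noteq> w\<close> by (auto simp: doubleton_eq_iff)
  have ij: "i \<in> {1..N}" "j \<in> {1..N}" "i \<noteq> j"
    using color_range uv vw edge_eqI_same_color[OF uv vw, of v] ne by (auto simp: i_def j_def)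
  obtain \<C> where cyc: "\<And>C. C \<in> \<C> \<Longrightarrow> is_4_cycle C"
    and disj: "\<And>C C'. C \<in> \<C> \<Longrightarrow> C' \<in> \<C> \<Longrightarrow> C \<noteq> C' \<Longrightarrow> \<Union> C \<inter> \<Union> C' = {}"
    and un: "\<Union> \<C> = bicolor_edges E color i j"
    using bicolor_subgraph[OF ij] unfolding disjoint_union_of_4_cycles_def by metis
  have "{u, v} \<in> \<Union> \<C>" "{v, w} \<in> \<Union> \<C>"
    using uv vw unfolding un bicolor_edges_def i_def j_def by auto
  then obtain C C' where C: "C \<in> \<C>" "{u, v} \<in> C" and C': "C' \<in> \<C>" "{v, w} \<in> C'" by blast
  have "v \<in> \<Union> C \<inter> \<Union> C'" using C C' by blast
  \<comment> \<open>Distinct components are vertex-disjoint, but these two share \<open>v\<close>.\<close>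
  then have "C' = C" using disj[OF C(1) C'(1)] by blast
  then obtain x where d: "distinct [u, v, w, x]"
    and Ceq: "C = {{u, v}, {v, w}, {w, x}, {x, u}}"
    using is_4_cycle_through_path[OF cyc[OF C(1)] C(2) _ \<open>u \<noteq> w\<close>] C'(2) by metis
  have bic: "bicolor_cycle E color i j C"
    using cyc[OF C(1)] C(1) un unfolding bicolor_cycle_def by blast
  then have sub: "C \<subseteq> E" and col: "\<And>e. e \<in> C \<Longrightarrow> color e = i \<or> color e = j"
    unfolding bicolor_cycle_def bicolor_edges_def by auto
  have wx: "{w, x} \<in> E" and xu: "{x, u} \<in> E" using sub Ceq by auto
  have "{w, x} \<noteq> {v, w}" "{x, u} \<noteq> {u, v}" using d by (auto simp: doubleton_eq_iff)
  then have "color {w, x} \<noteq> j" "color {x, u} \<noteq> i"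
    using edge_eqI_same_color[OF wx vw, of w] edge_eqI_same_color[OF xu uv, of u]
    by (auto simp: i_def j_def)
  then have cols: "color {w, x} = i" "color {x, u} = j" using col Ceq by auto
  have sgn: "\<mu> e \<in> {-1, 1}" if "e \<in> C" for e using signature sub that by blast
  have "prod \<mu> C = -1"
    using prod_signs[of C \<mu>] sgn odd_dashed[OF ij bic] by (simp add: Ceq)
  then have p: "\<mu> {u, v} * \<mu> {v, w} * \<mu> {w, x} * \<mu> {x, u} = -1"
    using prod_4_cycle[OF d] Ceq by simp
  have "\<mu> {u, v} \<in> {-1, 1}" "\<mu> {v, w} \<in> {-1, 1}" "\<mu> {w, x} \<in> {-1, 1}" "\<mu> {x, u} \<in> {-1, 1}"
    using sgn Ceq by auto
  then have "\<mu> {x, u} * \<mu> {w, x} = - (\<mu> {u, v} * \<mu> {v, w})" using p by auto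
  then show thesis
    using that[of x] wx xu cols by (simp add: insert_commute i_def j_def)
qed

definition adj :: "'v \<Rightarrow> 'v \<Rightarrow> real" where
  "adj u v = (if {u, v} \<in> E then of_int (\<mu> {u, v}) else 0)"

lemma card_neighbours:
  assumes "u \<in> V"
  shows "card {v \<in> V. {u, v} \<in> E} = N"
proof -
  have "bij_betw (\<lambda>v. {u, v}) {v \<in> V. {u, v} \<in> E} {e \<in> E. u \<in> e}"
  proof (intro bij_betw_imageI subset_antisym subsetI)
    show "inj_on (\<lambda>v. {u, v}) {v \<in> V. {u, v} \<in> E}"
      by (auto simp: inj_on_def doubleton_eq_iff)
  next
    fix e assume e: "e \<in> {e \<in> E. u \<in> e}"
    then obtain a b where "e = {a, b}" using edges[of e] by (auto simp: card_2_iff)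
    then obtain v where "e = {u, v}" using e by auto
    then show "e \<in> (\<lambda>v. {u, v}) ` {v \<in> V. {u, v} \<in> E}"
      using e edge_ends[of u v] by auto
  qed auto
  from bij_betw_same_card[OF this] show ?thesis by (simp only: regular[OF assms])
qed

lemma sum_adj_squares:
  assumes "u \<in> V"
  shows "(\<Sum>v\<in>V. adj u v * adj v u) = real N"
proof -
  have "adj u v * adj v u = (if {u, v} \<in> E then 1 else 0)" for v
    using signature[of "{u, v}"] by (auto simp: adj_def insert_commute)
  then have "(\<Sum>v\<in>V. adj u v * adj v u) = (\<Sum>v\<in>V. if {u, v} \<in> E then 1 else 0)"
    by simp
  also have "\<dots> = (\<Sum>v | v \<in> V \<and> {u, v} \<in> E. 1)"
    using finite_V by (intro sum.inter_filter[symmetric])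
  finally show ?thesis using card_neighbours[OF assms] by simp
qed

text \<open>Swapping the two sides of bicolor cycles pairs the middle vertices of the paths from \<open>u\<close> to \<open>w\<close>
  with opposite contributions.\<close>

lemma sum_adj_paths_distinct:
  assumes "u \<noteq> w"
  shows "(\<Sum>v\<in>V. adj u v * adj v w) = 0"
proof -
  define T where "T = {v \<in> V. {u, v} \<in> E \<and> {v, w} \<in> E}"
  have "\<exists>x. {u, x} \<in> E \<and> {x, w} \<in> E \<and> color {u, x} = color {v, w}
      \<and> color {x, w} = color {u, v} \<and> \<mu> {u, x} * \<mu> {x, w} = - (\<mu> {u, v} * \<mu> {v, w})"
    if "v \<in> T" for v
    using that bicolor_square[of u v w] assms unfolding T_def by blast
  then obtain g where g: "\<And>v. v \<in> T \<Longrightarrow> {u, g v} \<in> E \<and> {g v, w} \<in> E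
      \<and> color {u, g v} = color {v, w} \<and> color {g v, w} = color {u, v}
      \<and> \<mu> {u, g v} * \<mu> {g v, w} = - (\<mu> {u, v} * \<mu> {v, w})"
    by metis
  have gT: "g v \<in> T" if "v \<in> T" for v
    using g[OF that] edge_ends[of u "g v"] by (auto simp: T_def)
  have gg: "g (g v) = v" if "v \<in> T" for v
  proof -
    \<comment> \<open>Each application of \<open>g\<close> exchanges the colors of the two edges of the path, so the second
      one restores them, and an edge at \<open>u\<close> is determined by its color.\<close>
    have "{u, g (g v)} = {u, v}"
      using g[OF that] g[OF gT[OF that]] that
      by (intro edge_eqI_same_color[of _ _ u]) (auto simp: T_def)
    then show ?thesis by (auto simp: doubleton_eq_iff)
  qed
  have neg: "adj u (g v) * adj (g v) w = - (adj u v * adj v w)" if "v \<in> T" for v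
  proof -
    have "real_of_int (\<mu> {u, g v} * \<mu> {g v, w}) = real_of_int (- (\<mu> {u, v} * \<mu> {v, w}))"
      using g[OF that] by presburger
    then show ?thesis using g[OF that] that by (simp add: T_def adj_def flip: of_int_mult)
  qed
  have "(\<Sum>v\<in>T. adj u v * adj v w) = (\<Sum>v\<in>T. adj u (g v) * adj (g v) w)"
    by (rule sum.reindex_bij_witness[of _ g g]) (auto simp: gT gg)
  also have "\<dots> = - (\<Sum>v\<in>T. adj u v * adj v w)"
    by (simp add: neg sum_negf)
  finally have "(\<Sum>v\<in>T. adj u v * adj v w) = 0" by simp
  moreover have "(\<Sum>v\<in>V. adj u v * adj v w) = (\<Sum>v\<in>T. adj u v * adj v w)"
    using finite_V by (intro sum.mono_neutral_right) (auto simp: T_def adj_def)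
  ultimately show ?thesis by simp
qed

section \<open>The adjacency matrix and the parity of vertices\<close>

lemma signed_adjacency_carrier:
  "signed_adjacency_matrix vs E \<mu> \<in> carrier_mat (length vs) (length vs)"
  by (simp add: signed_adjacency_matrix_def)

lemma signed_adjacency_index:
  "i < length vs \<Longrightarrow> j < length vs \<Longrightarrow>
    signed_adjacency_matrix vs E \<mu> $$ (i, j) = adj (vs ! i) (vs ! j)"
  by (simp add: signed_adjacency_matrix_def adj_def)

lemma signed_adjacency_square:
  assumes "distinct vs" and "set vs = V"
  shows "signed_adjacency_matrix vs E \<mu> * signed_adjacency_matrix vs E \<mu>
    = real N \<cdot>\<^sub>m 1\<^sub>m (length vs)"
proof (rule eq_matI)
  fix i j assume "i < dim_row (real N \<cdot>\<^sub>m 1\<^sub>m (length vs))"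
    and "j < dim_col (real N \<cdot>\<^sub>m 1\<^sub>m (length vs))"
  then have ij: "i < length vs" "j < length vs" by auto
  have "(signed_adjacency_matrix vs E \<mu> * signed_adjacency_matrix vs E \<mu>) $$ (i, j)
      = (\<Sum>k = 0..<length vs. adj (vs ! i) (vs ! k) * adj (vs ! k) (vs ! j))"
    using ij signed_adjacency_carrier[of vs]
    by (auto simp: scalar_prod_def signed_adjacency_index intro!: sum.cong)
  also have "\<dots> = (\<Sum>v\<in>V. adj (vs ! i) v * adj v (vs ! j))"
    using bij_betw_nth[OF assms(1) refl] assms(2)
    by (intro sum.reindex_bij_betw) (simp add: atLeast0LessThan)
  also have "\<dots> = (real N \<cdot>\<^sub>m 1\<^sub>m (length vs)) $$ (i, j)"
    using ij assms sum_adj_squares[of "vs ! i"] sum_adj_paths_distinct[of "vs ! i" "vs ! j"]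
    by (auto simp: nth_eq_iff_index_eq)
  finally show "(signed_adjacency_matrix vs E \<mu> * signed_adjacency_matrix vs E \<mu>) $$ (i, j)
      = (real N \<cdot>\<^sub>m 1\<^sub>m (length vs)) $$ (i, j)" .
qed (use signed_adjacency_carrier[of vs] in auto)

lemma signed_laplacian_eq:
  assumes "set vs = V"
  shows "signed_laplacian vs E \<mu>
    = real N \<cdot>\<^sub>m 1\<^sub>m (length vs) - signed_adjacency_matrix vs E \<mu>"
proof -
  have "degree_matrix vs E = real N \<cdot>\<^sub>m 1\<^sub>m (length vs)"
    unfolding degree_matrix_def mat_diag_def using regular assms by (intro eq_matI) auto
  then show ?thesis unfolding signed_laplacian_def by simp
qed

definition parity_matrix :: "'v list \<Rightarrow> real mat" where
  "parity_matrix vs = mat_diag (length vs) (\<lambda>i. if vs ! i \<in> bosons then 1 else -1)"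

lemma parity_carrier: "parity_matrix vs \<in> carrier_mat (length vs) (length vs)"
  by (simp add: parity_matrix_def)

lemma parity_square: "parity_matrix vs * parity_matrix vs = 1\<^sub>m (length vs)"
proof -
  have "(\<lambda>i. (if vs ! i \<in> bosons then 1 else -1 :: real) * (if vs ! i \<in> bosons then 1 else -1))
      = (\<lambda>i. 1)"
    by auto
  then show ?thesis unfolding parity_matrix_def mat_diag_diag by simp
qed

text \<open>Multiplication by the parity on the left and on the right gives every nonzero entry of the
  adjacency matrix the signs of its row and of its column, and these differ because an edge
  joins a boson to a fermion.\<close>

lemma parity_anticommutes:
  "parity_matrix vs * signed_adjacency_matrix vs E \<mu>
    = - (signed_adjacency_matrix vs E \<mu> * parity_matrix vs)"
proof -
  have opposite: "(u \<in> bosons) \<noteq> (v \<in> bosons)" if "{u, v} \<in> E" for u v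
    using bipartite[OF that] bipartition by (auto simp: doubleton_eq_iff)
  show ?thesis
    unfolding parity_matrix_def
    by (subst mat_diag_mult_left[OF signed_adjacency_carrier],
        subst mat_diag_mult_right[OF signed_adjacency_carrier], rule eq_matI)
      (auto simp: signed_adjacency_index adj_def dest: opposite)
qed

end

section \<open>Spectra of anticommuting square roots\<close>

text \<open>The involution \<open>S\<close> conjugates \<open>t I + A\<close> to \<open>t I - A\<close>, so both have the same determinant, while
  their product is the scalar matrix \<open>(t\<^sup>2 - c) I\<close>.\<close>

lemma det_shift_anticommuting_root:
  fixes A S :: "'a :: idom mat"
  assumes A: "A \<in> carrier_mat n n" and S: "S \<in> carrier_mat n n"
    and SS: "S * S = 1\<^sub>m n" and SA: "S * A = - (A * S)" and AA: "A * A = c \<cdot>\<^sub>m 1\<^sub>m n"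
  shows "det (t \<cdot>\<^sub>m 1\<^sub>m n + A) ^ 2 = (t ^ 2 - c) ^ n"
proof -
  have t: "t \<cdot>\<^sub>m 1\<^sub>m n \<in> carrier_mat n n" by simp
  have "(t \<cdot>\<^sub>m 1\<^sub>m n + A) * S = t \<cdot>\<^sub>m S + A * S"
    using A S by (simp add: add_mult_distrib_mat[OF t A S] mult_smult_assoc_mat[OF one_carrier_mat S])
  also have "\<dots> = t \<cdot>\<^sub>m S - S * A"
    using A S unfolding SA by (intro eq_matI) auto
  also have "\<dots> = S * (t \<cdot>\<^sub>m 1\<^sub>m n - A)"
    using A S by (simp add: mult_minus_distrib_mat[OF S t A] mult_smult_distrib[OF S one_carrier_mat])
  finally have "det (t \<cdot>\<^sub>m 1\<^sub>m n + A) * det S = det S * det (t \<cdot>\<^sub>m 1\<^sub>m n - A)"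
    using A S by (metis det_mult add_carrier_mat minus_carrier_mat)
  moreover have "det S \<noteq> 0"
    using det_mult[OF S S] SS by auto
  ultimately have eq: "det (t \<cdot>\<^sub>m 1\<^sub>m n - A) = det (t \<cdot>\<^sub>m 1\<^sub>m n + A)" by simp
  have tm: "t \<cdot>\<^sub>m 1\<^sub>m n - A \<in> carrier_mat n n" by (rule minus_carrier_mat[OF A])
  have "(t \<cdot>\<^sub>m 1\<^sub>m n + A) * (t \<cdot>\<^sub>m 1\<^sub>m n - A)
      = t \<cdot>\<^sub>m (t \<cdot>\<^sub>m 1\<^sub>m n - A) + (t \<cdot>\<^sub>m A - A * A)"
    using A tm by (simp add: add_mult_distrib_mat[OF t A tm] mult_minus_distrib_mat[OF A t A]
        mult_smult_assoc_mat[OF one_carrier_mat tm] mult_smult_distrib[OF A one_carrier_mat])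
  also have "\<dots> = (t ^ 2 - c) \<cdot>\<^sub>m 1\<^sub>m n"
    unfolding AA using A by (intro eq_matI) (auto simp: power2_eq_square algebra_simps)
  finally have "det (t \<cdot>\<^sub>m 1\<^sub>m n + A) * det (t \<cdot>\<^sub>m 1\<^sub>m n - A) = (t ^ 2 - c) ^ n"
    using A tm by (simp flip: det_mult[of _ n])
  then show ?thesis by (simp add: eq power2_eq_square)
qed

text \<open>Squaring doubles the order of every root, which forces \<open>n\<close> to be even. Then
  the right-hand side is itself the square of a monic polynomial, and square roots in an integral
  domain are unique up to sign; the leading coefficient decides the sign.\<close>

lemma monic_square_root_of_power:
  fixes p :: "'a :: {idom, ring_char_0} poly"
  assumes "monic p" and "a \<noteq> b" and sq: "p ^ 2 = ([:-a, 1:] * [:-b, 1:]) ^ n"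
  shows "2 * order a p = n" and "2 * order b p = n"
    and "p = ([:-a, 1:] * [:-b, 1:]) ^ (n div 2)"
proof -
  have p0: "p \<noteq> 0" using assms(1) by auto
  have ord: "2 * order x p = n" if xy: "x \<noteq> y" and eq: "p ^ 2 = ([:-x, 1:] * [:-y, 1:]) ^ n" for x y
  proof -
    have "order x (p ^ 2) = 2 * order x p"
      using p0 by (simp add: power2_eq_square order_mult)
    moreover have "order x (([:-x, 1:] * [:-y, 1:]) ^ n) = n"
    proof -
      have "order x ([:-x, 1:] ^ n * [:-y, 1:] ^ n)
          = order x ([:-x, 1:] ^ n) + order x ([:-y, 1:] ^ n)"
        by (intro order_mult) simp
      also have "\<dots> = n"
        using xy by (simp add: order_power_n_n order_0I poly_power)
      finally show ?thesis by (simp only: power_mult_distrib)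
    qed
    ultimately show ?thesis using eq by simp
  qed
  show a: "2 * order a p = n" using ord assms(2) sq .
  show "2 * order b p = n" using ord[of b a] assms(2) sq by (simp only: mult.commute) auto
  define q where "q = ([:-a, 1:] * [:-b, 1:]) ^ (n div 2)"
  have "q ^ 2 = ([:-a, 1:] * [:-b, 1:]) ^ n"
    unfolding q_def power_mult[symmetric] using a by (metis dvd_div_mult_self dvd_triv_left)
  then have "p = q \<or> p = - q" using sq power2_eq_iff by metis
  moreover have "monic q"
    unfolding q_def by (intro monic_power monic_mult) simp_all
  ultimately show "p = q" using assms(1) by auto
qed

section \<open>The spectrum of the signed Laplacian\<close>

theorem corollary10:
  fixes V :: "'v set" and E :: "'v set set" and \<mu> :: "'v set \<Rightarrow> int"
    and bosons fermions :: "'v set" and N :: nat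
    and color :: "'v set \<Rightarrow> nat" and h :: "'v \<Rightarrow> int"
    and vs :: "'v list" and L :: "real mat"
  assumes "adinkra V E \<mu> bosons fermions N color h"
    and "distinct vs" and "set vs = V"
    and "L = signed_laplacian vs E \<mu>"
  shows "{x. eigenvalue L x} = {real N + sqrt (real N), real N - sqrt (real N)}
    \<and> real (Polynomial.order (real N + sqrt (real N)) (char_poly L)) = real (card V) / 2
    \<and> real (Polynomial.order (real N - sqrt (real N)) (char_poly L)) = real (card V) / 2
    \<and> L ^\<^sub>m 2 = (2 * real N) \<cdot>\<^sub>m L - (real N * (real N - 1)) \<cdot>\<^sub>m 1\<^sub>m (card V)
    \<and> det L = (real N * (real N - 1)) ^ (card V div 2)"
proof -
  interpret adinkra V E \<mu> bosons fermions N color h by (fact assms(1))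
  define n where "n = length vs"
  define A where "A = signed_adjacency_matrix vs E \<mu>"
  define a b where "a = real N + sqrt (real N)" and "b = real N - sqrt (real N)"
  define p where "p = char_poly L"
  have n: "card V = n" using assms(2,3) distinct_card n_def by metis
  have n0: "n > 0" using n nonempty finite_V by auto
  have A: "A \<in> carrier_mat n n" unfolding A_def n_def by (rule signed_adjacency_carrier)
  have AA: "A * A = real N \<cdot>\<^sub>m 1\<^sub>m n"
    unfolding A_def n_def by (rule signed_adjacency_square[OF assms(2,3)])
  have L: "L = real N \<cdot>\<^sub>m 1\<^sub>m n - A"
    unfolding A_def n_def assms(4) by (rule signed_laplacian_eq[OF assms(3)])
  have Lc: "L \<in> carrier_mat n n" unfolding L by (rule minus_carrier_mat[OF A])
  have ab: "a \<noteq> b" using N_pos by (simp add: a_def b_def)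
  have ab_prod: "a * b = real N * (real N - 1)"
    by (simp add: a_def b_def algebra_simps)
  have "poly (p ^ 2) x = poly (([:-a, 1:] * [:-b, 1:]) ^ n) x" for x
  proof -
    have "- char_matrix L x = (x - real N) \<cdot>\<^sub>m 1\<^sub>m n + A"
      using A unfolding char_matrix_def L by (intro eq_matI) auto
    then have "poly (p ^ 2) x = det ((x - real N) \<cdot>\<^sub>m 1\<^sub>m n + A) ^ 2"
      using char_poly_matrix[OF Lc, of x] by (simp add: p_def poly_power)
    also have "\<dots> = ((x - real N) ^ 2 - real N) ^ n"
      using A AA parity_square[of vs] parity_carrier[of vs] parity_anticommutes[of vs]
      by (intro det_shift_anticommuting_root[of _ n "parity_matrix vs"]) (auto simp: A_def n_def)
    also have "(x - real N) ^ 2 - real N = (x - a) * (x - b)"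
      by (simp add: a_def b_def power2_eq_square algebra_simps)
    finally show ?thesis by (simp add: poly_power algebra_simps)
  qed
  \<comment> \<open>A polynomial over the infinite field of real numbers is determined by its values.\<close>
  then have sq: "p ^ 2 = ([:-a, 1:] * [:-b, 1:]) ^ n"
    by (intro poly_eq_poly_eq_iff[THEN iffD1] ext)
  have "monic p" using degree_monic_char_poly[OF Lc] by (simp add: p_def)
  note root = monic_square_root_of_power[OF this ab sq]
  have n2: "n div 2 > 0" using root(1) n0 by presburger
  have p_at: "poly p x = ((x - a) * (x - b)) ^ (n div 2)" for x
    by (subst root(3)) (simp add: poly_power algebra_simps)
  have "eigenvalue L x \<longleftrightarrow> x = a \<or> x = b" for x
  proof -
    have "eigenvalue L x \<longleftrightarrow> poly p x = 0"
      unfolding p_def by (rule eigenvalue_root_char_poly[OF Lc])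
    also have "\<dots> \<longleftrightarrow> x = a \<or> x = b"
      using n2 unfolding p_at by simp
    finally show ?thesis .
  qed
  moreover have "L ^\<^sub>m 2 = (2 * real N) \<cdot>\<^sub>m L - (real N * (real N - 1)) \<cdot>\<^sub>m 1\<^sub>m n"
  proof -
    have N1: "real N \<cdot>\<^sub>m 1\<^sub>m n \<in> carrier_mat n n" by simp
    have "L ^\<^sub>m 2 = L * L" using Lc by (simp add: numeral_2_eq_2)
    also have "\<dots> = real N \<cdot>\<^sub>m L - (real N \<cdot>\<^sub>m A - A * A)"
    proof -
      have "L * L = real N \<cdot>\<^sub>m L - A * L"
        using minus_mult_distrib_mat[OF N1 A Lc] mult_smult_assoc_mat[OF one_carrier_mat Lc] Lc
        by (simp flip: L)
      also have "A * L = real N \<cdot>\<^sub>m A - A * A"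
        unfolding L using A mult_minus_distrib_mat[OF A N1 A]
          mult_smult_distrib[OF A one_carrier_mat] by simp
      finally show ?thesis .
    qed
    also have "\<dots> = (2 * real N) \<cdot>\<^sub>m L - (real N * (real N - 1)) \<cdot>\<^sub>m 1\<^sub>m n"
      unfolding AA L using A by (intro eq_matI) (auto simp: algebra_simps)
    finally show ?thesis .
  qed
  moreover have "det L = (real N * (real N - 1)) ^ (n div 2)"
  proof -
    have "- char_matrix L 0 = (-1) \<cdot>\<^sub>m L"
      using Lc unfolding char_matrix_def by (intro eq_matI) auto
    then have "poly p 0 = (-1) ^ n * det L"
      using char_poly_matrix[OF Lc, of 0] Lc by (simp add: p_def)
    moreover have "even n" using root(1) by (metis dvd_triv_left)
    moreover have "poly p 0 = (a * b) ^ (n div 2)"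
      by (simp add: p_at)
    ultimately show ?thesis by (simp add: ab_prod)
  qed
  ultimately show ?thesis
    using root(1,2) unfolding n by (auto simp: a_def b_def p_def)
qed

end
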